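(* Let $G$ be a finite group acting on a set $\mathcal{X}$ with a $G$-invariant probability measure $\mu_{\mathcal{X}}$, and let $\mathcal{A}$ be a $G$-equivariant kernel method. For any $\varepsilon>0$ and any $h\in L^2(\mathcal{X})$ with $\|h\|_2=1$, suppose that the kernel method $\mathcal{A}(S)$ on a sample $S=(x_i,y_i)_{i\in[n]}$ with $y_i=h(x_i)$ achieves $\|\mathcal{A}(S)-h\|_2^2<\varepsilon$. Then $$\min(n,\eta)\ge\frac{|G|}{\|\Gamma\|_{\mathrm{op}}}(1-\varepsilon)=\frac{1-\varepsilon}{\mathrm{A}(h,G)},$$ where $\eta=\dim\mathscr{H}_K$ and $\Gamma=(\langle U_gh,U_{g'}h\rangle)_{g,g'\in G}$ is the Gram matrix of $\{U_gh:g\in G\}$.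
   Context: $L^2(\mathcal{X})=L^2(\mu_{\mathcal{X}})$ (real-valued) with inner product $\langle\cdot,\cdot\rangle$ and norm $\|\cdot\|_2$; $U_gh=h\circ g$. Alignment: $\mathrm{A}(h,G)=\sup_{\|\phi\|_2=1}\mathbb{E}_{g\sim\mu_G}[|\langle U_gh,\phi\rangle|^2]$ with $\mu_G$ the uniform measure on $G$. A kernel method: a symmetric positive definite kernel $K$ on $\mathcal{X}$ with RKHS $\mathscr{H}_K$, a loss $\ell$ and $\lambda>0$; on sample $S$ it outputs $\mathcal{A}(S)=\operatorname{argmin}_{f\in\mathscr{H}_K}\{\frac1n\sum_i\ell(f(x_i),y_i)+\lambda\|f\|_{\mathscr{H}_K}^2\}$. It is $G$-equivariant when $K$ is $G$-invariant ($K(gx,gy)=K(x,y)$) and this minimizer is unique, so that $\mathcal{A}(g^{-1}S)=\mathcal{A}(S)\circ g$ where $g^{-1}S=(g^{-1}x_i,y_i)_i$.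
   Formalization: For one fixed sample S the bound on n is false; it is proved when the error is below ε on S and on all its G-translates (relabelled by h), or in expectation over i.i.d. samples from the measure on X. For a single fixed sample only the bound on η is proved. *)

theory Defs
  imports "HOL-Probability.Probability" "HOL-Algebra.Group_Action" "HOL-Library.Function_Algebras"
begin

section \<open>Square-integrable functions\<close>

text \<open>Elements of L2 are genuine functions, not almost-everywhere classes, because a sample is
  labelled with the point values of the target function.\<close>

definition L2 :: "'a measure \<Rightarrow> ('a \<Rightarrow> real) set" where
  "L2 M = {f \<in> borel_measurable M. integrable M (\<lambda>x. (f x)\<^sup>2)}"

definition l2_inner :: "'a measure \<Rightarrow> ('a \<Rightarrow> real) \<Rightarrow> ('a \<Rightarrow> real) \<Rightarrow> real" where
  "l2_inner M f g = (\<integral>x. f x * g x \<partial>M)"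

definition l2_norm :: "'a measure \<Rightarrow> ('a \<Rightarrow> real) \<Rightarrow> real" where
  "l2_norm M f = sqrt (l2_inner M f f)"

section \<open>Group action, alignment and Gram matrix\<close>

definition invariant_measure ::
    "('g, 'b) monoid_scheme \<Rightarrow> ('g \<Rightarrow> 'a \<Rightarrow> 'a) \<Rightarrow> 'a measure \<Rightarrow> bool" where
  "invariant_measure G act M \<longleftrightarrow>
     (\<forall>g\<in>carrier G. act g \<in> measurable M M \<and> distr M M (act g) = M)"

definition translate :: "('g \<Rightarrow> 'a \<Rightarrow> 'a) \<Rightarrow> 'g \<Rightarrow> ('a \<Rightarrow> real) \<Rightarrow> 'a \<Rightarrow> real" where
  "translate act g h = h \<circ> act g"

definition alignment ::
    "('g, 'b) monoid_scheme \<Rightarrow> ('g \<Rightarrow> 'a \<Rightarrow> 'a) \<Rightarrow> 'a measure \<Rightarrow> ('a \<Rightarrow> real) \<Rightarrow> real" where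
  "alignment G act M h =
     (SUP \<phi>\<in>{\<phi> \<in> L2 M. l2_norm M \<phi> = 1}.
        measure_pmf.expectation (pmf_of_set (carrier G))
          (\<lambda>g. \<bar>l2_inner M (translate act g h) \<phi>\<bar>\<^sup>2))"

definition gram :: "('g \<Rightarrow> 'a \<Rightarrow> 'a) \<Rightarrow> 'a measure \<Rightarrow> ('a \<Rightarrow> real) \<Rightarrow> 'g \<Rightarrow> 'g \<Rightarrow> real" where
  "gram act M h g g' = l2_inner M (translate act g h) (translate act g' h)"

text \<open>Operator norm, for the Euclidean norm, of a real square matrix indexed by a finite set.\<close>

definition mat_opnorm :: "'i set \<Rightarrow> ('i \<Rightarrow> 'i \<Rightarrow> real) \<Rightarrow> real" where
  "mat_opnorm I A = (SUP v\<in>{v. L2_set v I \<le> 1}. L2_set (\<lambda>i. \<Sum>j\<in>I. A i j * v j) I)"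

section \<open>Reproducing kernel Hilbert spaces\<close>

global_interpretation fun_vs: vector_space "\<lambda>(c::real) (f :: 'a \<Rightarrow> real) x. c * f x"
  by unfold_locales (simp_all add: fun_eq_iff algebra_simps)

text \<open>As usual for kernels, positive definite means that all kernel matrices are positive
  semidefinite.\<close>

definition spd_kernel :: "('a \<Rightarrow> 'a \<Rightarrow> real) \<Rightarrow> bool" where
  "spd_kernel K \<longleftrightarrow>
     (\<forall>x y. K x y = K y x) \<and>
     (\<forall>F c. finite F \<longrightarrow> (\<Sum>x\<in>F. \<Sum>y\<in>F. c x * c y * K x y) \<ge> 0)"

definition is_inner_product ::
    "('a \<Rightarrow> real) set \<Rightarrow> (('a \<Rightarrow> real) \<Rightarrow> ('a \<Rightarrow> real) \<Rightarrow> real) \<Rightarrow> bool" where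
  "is_inner_product H ip \<longleftrightarrow>
     (\<forall>f\<in>H. \<forall>g\<in>H. ip f g = ip g f) \<and>
     (\<forall>f\<in>H. \<forall>g\<in>H. \<forall>k\<in>H. ip (f + g) k = ip f k + ip g k) \<and>
     (\<forall>f\<in>H. \<forall>g\<in>H. \<forall>c. ip (\<lambda>x. c * f x) g = c * ip f g) \<and>
     (\<forall>f\<in>H. ip f f \<ge> 0) \<and>
     (\<forall>f\<in>H. ip f f = 0 \<longrightarrow> f = 0)"

definition ip_complete ::
    "('a \<Rightarrow> real) set \<Rightarrow> (('a \<Rightarrow> real) \<Rightarrow> ('a \<Rightarrow> real) \<Rightarrow> real) \<Rightarrow> bool" where
  "ip_complete H ip \<longleftrightarrow>
     (\<forall>u :: nat \<Rightarrow> 'a \<Rightarrow> real.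
        (\<forall>n. u n \<in> H) \<and>
        (\<forall>e>0. \<exists>N. \<forall>m\<ge>N. \<forall>n\<ge>N. sqrt (ip (u m - u n) (u m - u n)) < e) \<longrightarrow>
        (\<exists>f\<in>H. (\<lambda>n. sqrt (ip (u n - f) (u n - f))) \<longlonglongrightarrow> 0))"

text \<open>The pair of \<open>H\<close> and \<open>ip\<close> is the Hilbert space of functions with reproducing kernel \<open>K\<close>.
  By the Moore-Aronszajn theorem it exists for every symmetric positive definite \<open>K\<close>, and \<open>H\<close> and
  the values of \<open>ip\<close> on \<open>H\<close> are uniquely determined.\<close>

definition is_rkhs ::
    "('a \<Rightarrow> 'a \<Rightarrow> real) \<Rightarrow> ('a \<Rightarrow> real) set \<Rightarrow> (('a \<Rightarrow> real) \<Rightarrow> ('a \<Rightarrow> real) \<Rightarrow> real) \<Rightarrow> bool" where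
  "is_rkhs K H ip \<longleftrightarrow>
     fun_vs.subspace H \<and> is_inner_product H ip \<and> ip_complete H ip \<and>
     (\<forall>x. K x \<in> H) \<and> (\<forall>f\<in>H. \<forall>x. ip f (K x) = f x)"

text \<open>Without the case distinction, \<open>fun_vs.dim\<close> would be a meaningless number on
  infinite-dimensional spaces.\<close>

definition fun_dim :: "('a \<Rightarrow> real) set \<Rightarrow> enat" where
  "fun_dim H = (if \<exists>B. finite B \<and> H \<subseteq> fun_vs.span B then enat (fun_vs.dim H) else \<infinity>)"

section \<open>Kernel methods\<close>

definition reg_risk ::
    "(('a \<Rightarrow> real) \<Rightarrow> ('a \<Rightarrow> real) \<Rightarrow> real) \<Rightarrow> (real \<Rightarrow> real \<Rightarrow> real) \<Rightarrow> real \<Rightarrow>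
     ('a \<times> real) list \<Rightarrow> ('a \<Rightarrow> real) \<Rightarrow> real" where
  "reg_risk ip l lam S f =
     1 / real (length S) * (\<Sum>i<length S. l (f (fst (S ! i))) (snd (S ! i))) + lam * ip f f"

definition kernel_method ::
    "('a \<Rightarrow> real) set \<Rightarrow> (('a \<Rightarrow> real) \<Rightarrow> ('a \<Rightarrow> real) \<Rightarrow> real) \<Rightarrow>
     (real \<Rightarrow> real \<Rightarrow> real) \<Rightarrow> real \<Rightarrow> ('a \<times> real) list \<Rightarrow> 'a \<Rightarrow> real" where
  "kernel_method H ip l lam S = arg_min (reg_risk ip l lam S) (\<lambda>f. f \<in> H)"

definition equivariant_kernel_method ::
    "('g, 'b) monoid_scheme \<Rightarrow> ('g \<Rightarrow> 'a \<Rightarrow> 'a) \<Rightarrow> ('a \<Rightarrow> 'a \<Rightarrow> real) \<Rightarrow> ('a \<Rightarrow> real) set \<Rightarrow>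
     (('a \<Rightarrow> real) \<Rightarrow> ('a \<Rightarrow> real) \<Rightarrow> real) \<Rightarrow> (real \<Rightarrow> real \<Rightarrow> real) \<Rightarrow> real \<Rightarrow> bool" where
  "equivariant_kernel_method G act K H ip l lam \<longleftrightarrow>
     (\<forall>g\<in>carrier G. \<forall>x y. K (act g x) (act g y) = K x y) \<and>
     (\<forall>S. \<exists>!f. is_arg_min (reg_risk ip l lam S) (\<lambda>f. f \<in> H) f)"

definition labelled :: "('a \<Rightarrow> real) \<Rightarrow> 'a list \<Rightarrow> ('a \<times> real) list" where
  "labelled h xs = map (\<lambda>x. (x, h x)) xs"

definition sq_error ::
    "'a measure \<Rightarrow> (('a \<times> real) list \<Rightarrow> 'a \<Rightarrow> real) \<Rightarrow> ('a \<Rightarrow> real) \<Rightarrow> 'a list \<Rightarrow> real" where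
  "sq_error M A h xs = (l2_norm M (A (labelled h xs) - h))\<^sup>2"

text \<open>The membership condition is needed because the Bochner integral of a function that is not
  integrable is 0: without it, an output outside L2 could count as having no error.\<close>

definition achieves ::
    "'a measure \<Rightarrow> (('a \<times> real) list \<Rightarrow> 'a \<Rightarrow> real) \<Rightarrow> ('a \<Rightarrow> real) \<Rightarrow> real \<Rightarrow> 'a list \<Rightarrow> bool" where
  "achieves M A h eps xs \<longleftrightarrow> A (labelled h xs) \<in> L2 M \<and> sq_error M A h xs < eps"

text \<open>The guarantee in expectation over \<open>n\<close> independent sample points with law \<open>M\<close>.
  A guarantee at one fixed sample bounds the dimension of the RKHS but not the sample size: for a
  finite group acting on itself with uniform measure, the kernel that is 1 on the diagonal and 0
  elsewhere, and squared loss with small \<open>lam\<close>, a normalized point mass is learned from the single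
  sample at its support, although its alignment is the inverse of the group order.\<close>

definition achieves_iid ::
    "'a measure \<Rightarrow> (('a \<times> real) list \<Rightarrow> 'a \<Rightarrow> real) \<Rightarrow> ('a \<Rightarrow> real) \<Rightarrow> real \<Rightarrow> nat \<Rightarrow> bool" where
  "achieves_iid M A h eps n \<longleftrightarrow>
     (AE x in (\<Pi>\<^sub>M i\<in>{..<n}. M). A (labelled h (map x [0..<n])) \<in> L2 M) \<and>
     integrable (\<Pi>\<^sub>M i\<in>{..<n}. M) (\<lambda>x. sq_error M A h (map x [0..<n])) \<and>
     (\<integral>x. sq_error M A h (map x [0..<n]) \<partial>(\<Pi>\<^sub>M i\<in>{..<n}. M)) < eps"

end

theory Submission
  imports Defs
begin

text \<open>If every translate of \<open>h\<close> is, on average over the group, within squared distance \<open>\<epsilon>\<close> of one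
  \<open>d\<close>-dimensional space with orthonormal basis \<open>e\<^sub>1, \<dots>, e\<^sub>d\<close>, then Pythagoras gives
  \<open>|G| (1 - \<epsilon>) \<le> \<Sum>\<^sub>i \<Sum>\<^sub>g \<langle>U\<^sub>g h, e\<^sub>i\<rangle>\<^sup>2\<close>, and each of the \<open>d\<close> inner sums is at most the operator norm
  of the Gram matrix, which is \<open>|G|\<close> times the alignment. By the representer theorem the output on a
  sample lies in the span of the kernel sections at its points. Translating the outputs on all
  translates of the sample back brings them into the span for the original sample, which has
  dimension at most \<open>n\<close> and lies in the RKHS. For a guarantee in expectation, invariance of the
  product measure yields a sample on whose orbit the average error is below \<open>\<epsilon>\<close>.\<close>

section \<open>Semi-inner products on spaces of functions\<close>

text \<open>Nonzero functions may have norm 0, as on \<open>L2 M\<close>, where functions equal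
  almost everywhere are not identified. The same locale is instantiated with the RKHS, where
  definiteness is added by hand.\<close>

locale semi_inner =
  fixes H :: "('a \<Rightarrow> real) set" and ip :: "('a \<Rightarrow> real) \<Rightarrow> ('a \<Rightarrow> real) \<Rightarrow> real"
  assumes subspace_carrier: "fun_vs.subspace H"
    and ip_commute: "\<And>f g. f \<in> H \<Longrightarrow> g \<in> H \<Longrightarrow> ip f g = ip g f"
    and ip_add_left: "\<And>f g k. f \<in> H \<Longrightarrow> g \<in> H \<Longrightarrow> k \<in> H \<Longrightarrow> ip (f + g) k = ip f k + ip g k"
    and ip_scale_left: "\<And>c f g. f \<in> H \<Longrightarrow> g \<in> H \<Longrightarrow> ip (\<lambda>x. c * f x) g = c * ip f g"
    and ip_nonneg: "\<And>f. f \<in> H \<Longrightarrow> 0 \<le> ip f f"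
begin

lemma add_mem: "f \<in> H \<Longrightarrow> g \<in> H \<Longrightarrow> f + g \<in> H"
  using subspace_carrier by (rule fun_vs.subspace_add)

lemma diff_mem: "f \<in> H \<Longrightarrow> g \<in> H \<Longrightarrow> f - g \<in> H"
  using subspace_carrier by (rule fun_vs.subspace_diff)

lemma scale_mem: "f \<in> H \<Longrightarrow> (\<lambda>x. c * f x) \<in> H"
  using subspace_carrier by (rule fun_vs.subspace_scale)

lemma sum_mem: "(\<And>i. i \<in> I \<Longrightarrow> f i \<in> H) \<Longrightarrow> sum f I \<in> H"
  using subspace_carrier by (rule fun_vs.subspace_sum)

lemma zero_mem: "0 \<in> H"
  using subspace_carrier by (rule fun_vs.subspace_0)

lemma ip_zero_left: "g \<in> H \<Longrightarrow> ip 0 g = 0"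
  using ip_add_left[OF zero_mem zero_mem, of g] by simp

lemma ip_diff_left: "f \<in> H \<Longrightarrow> g \<in> H \<Longrightarrow> k \<in> H \<Longrightarrow> ip (f - g) k = ip f k - ip g k"
  using ip_add_left[of "f - g" g k] diff_mem[of f g] by simp

lemma ip_add_right: "f \<in> H \<Longrightarrow> g \<in> H \<Longrightarrow> k \<in> H \<Longrightarrow> ip k (f + g) = ip k f + ip k g"
  by (simp add: ip_commute[of k] add_mem ip_add_left)

lemma ip_diff_right: "f \<in> H \<Longrightarrow> g \<in> H \<Longrightarrow> k \<in> H \<Longrightarrow> ip k (f - g) = ip k f - ip k g"
  by (simp add: ip_commute[of k] diff_mem ip_diff_left)

lemma ip_scale_right: "f \<in> H \<Longrightarrow> g \<in> H \<Longrightarrow> ip g (\<lambda>x. c * f x) = c * ip g f"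
  by (simp add: ip_commute[of g] scale_mem ip_scale_left)

lemma ip_sum_left:
  assumes "\<And>i. i \<in> I \<Longrightarrow> f i \<in> H" "g \<in> H"
  shows "ip (sum f I) g = (\<Sum>i\<in>I. ip (f i) g)"
  using assms
  by (induction I rule: infinite_finite_induct) (simp_all add: ip_zero_left ip_add_left sum_mem)

lemma Cauchy_Schwarz:
  assumes "f \<in> H" "g \<in> H"
  shows "(ip f g)\<^sup>2 \<le> ip f f * ip g g"
proof -
  have quad: "0 \<le> ip f f - 2 * t * ip f g + t\<^sup>2 * ip g g" for t
  proof -
    have "0 \<le> ip (f - (\<lambda>x. t * g x)) (f - (\<lambda>x. t * g x))"
      using assms by (intro ip_nonneg diff_mem scale_mem)
    also have "\<dots> = ip f f - 2 * t * ip f g + t\<^sup>2 * ip g g"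
      using assms
      by (simp add: ip_diff_left ip_diff_right ip_scale_left ip_scale_right diff_mem scale_mem
          ip_commute[of g f] power2_eq_square algebra_simps)
    finally show ?thesis .
  qed
  show ?thesis
  proof (cases "ip g g = 0")
    case True
    have "ip f g = 0"
    proof (rule ccontr)
      assume "ip f g \<noteq> 0"
      \<comment> \<open>With \<open>ip g g = 0\<close> the quadratic is linear in \<open>t\<close>,
        and this \<open>t\<close> gives it the value -1.\<close>
      then show False
        using quad[of "(ip f f + 1) / (2 * ip f g)"] True by (simp add: field_simps)
    qed
    then show ?thesis by (simp add: True)
  next
    case False
    then have "0 < ip g g" using ip_nonneg[OF assms(2)] by simp
    \<comment> \<open>The quadratic is evaluated at its minimizer.\<close>
    then show ?thesis
      using quad[of "ip f g / ip g g"] by (simp add: field_simps power2_eq_square)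
  qed
qed

text \<open>By Cauchy-Schwarz. It is the substitute for definiteness: null functions may be dropped
  inside any inner product.\<close>

lemma null_ip:
  assumes "f \<in> H" "ip f f = 0" "g \<in> H"
  shows "ip f g = 0" "ip g f = 0"
  using Cauchy_Schwarz[OF assms(1,3)] assms by (auto simp: ip_commute[of g f])

section \<open>Orthogonal projection, residuals and Gram-Schmidt\<close>

definition proj :: "('a \<Rightarrow> real) set \<Rightarrow> ('a \<Rightarrow> real) \<Rightarrow> 'a \<Rightarrow> real" where
  "proj E f = (\<Sum>e\<in>E. (\<lambda>x. ip f e * e x))"

definition orthonormal :: "('a \<Rightarrow> real) set \<Rightarrow> bool" where
  "orthonormal E \<longleftrightarrow>
     finite E \<and> E \<subseteq> H \<and> (\<forall>e\<in>E. \<forall>e'\<in>E. ip e e' = (if e = e' then 1 else 0))"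

text \<open>For orthonormal \<open>E\<close> this is the squared distance from \<open>f\<close> to
  the span of \<open>E\<close>. The value 0 says that \<open>f\<close> lies in that span up to a
  null function.\<close>

definition resid :: "('a \<Rightarrow> real) set \<Rightarrow> ('a \<Rightarrow> real) \<Rightarrow> real" where
  "resid E f = ip (f - proj E f) (f - proj E f)"

lemma proj_mem: "E \<subseteq> H \<Longrightarrow> proj E f \<in> H"
  unfolding proj_def by (intro sum_mem scale_mem) auto

lemma proj_span: "proj E f \<in> fun_vs.span E"
  unfolding proj_def by (intro fun_vs.span_sum fun_vs.span_scale fun_vs.span_base)

lemma proj_add:
  assumes "E \<subseteq> H" "f \<in> H" "g \<in> H"
  shows "proj E (f + g) = proj E f + proj E g"
proof -
  have "proj E (f + g) = (\<Sum>e\<in>E. (\<lambda>x. ip f e * e x) + (\<lambda>x. ip g e * e x))"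
    unfolding proj_def
    using assms by (intro sum.cong refl) (auto simp: ip_add_left fun_eq_iff algebra_simps)
  then show ?thesis by (simp add: proj_def sum.distrib)
qed

lemma proj_scale:
  assumes "E \<subseteq> H" "f \<in> H"
  shows "proj E (\<lambda>x. c * f x) = (\<lambda>x. c * proj E f x)"
proof -
  have "proj E (\<lambda>x. c * f x) = (\<Sum>e\<in>E. (\<lambda>x. c * (\<lambda>x. ip f e * e x) x))"
    unfolding proj_def
    using assms by (intro sum.cong refl) (auto simp: ip_scale_left fun_eq_iff algebra_simps)
  also have "\<dots> = (\<lambda>x. c * proj E f x)"
    unfolding proj_def by (rule fun_vs.scale_sum_right[symmetric])
  finally show ?thesis .
qed

lemma proj_diff:
  assumes "E \<subseteq> H" "f \<in> H" "g \<in> H"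
  shows "proj E (f - g) = proj E f - proj E g"
  using proj_add[of E "f - g" g] assms by (simp add: diff_mem)

lemma ip_proj_left:
  assumes "E \<subseteq> H" "g \<in> H"
  shows "ip (proj E f) g = (\<Sum>e\<in>E. ip f e * ip e g)"
  using assms unfolding proj_def
  by (subst ip_sum_left) (auto simp: scale_mem ip_scale_left intro!: sum.cong)

lemma orthonormalD:
  assumes "orthonormal E"
  shows "finite E" "E \<subseteq> H" "e \<in> E \<Longrightarrow> ip e e = 1"
    "e \<in> E \<Longrightarrow> e' \<in> E \<Longrightarrow> e \<noteq> e' \<Longrightarrow> ip e e' = 0"
  using assms by (auto simp: orthonormal_def)

lemma ip_resid_basis:
  assumes "orthonormal E" "f \<in> H" "e \<in> E"
  shows "ip (f - proj E f) e = 0"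
proof -
  note E = orthonormalD[OF assms(1)]
  have e: "e \<in> H" using E(2) assms(3) by auto
  have "ip (proj E f) e = (\<Sum>e'\<in>E. ip f e' * ip e' e)"
    using E(2) e by (rule ip_proj_left)
  also have "\<dots> = (\<Sum>e'\<in>E. if e' = e then ip f e else 0)"
    using E(3,4) assms(3) by (intro sum.cong) auto
  also have "\<dots> = ip f e" using E(1) assms(3) by simp
  finally show ?thesis using assms(2) e E(2) by (simp add: ip_diff_left proj_mem)
qed

lemma ip_resid_proj:
  assumes "orthonormal E" "f \<in> H"
  shows "ip (f - proj E f) (proj E g) = 0"
proof -
  note E = orthonormalD(2)[OF assms(1)]
  have "ip (f - proj E f) (proj E g) = ip (proj E g) (f - proj E f)"
    using assms E by (intro ip_commute diff_mem proj_mem)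
  also have "\<dots> = (\<Sum>e\<in>E. ip g e * ip e (f - proj E f))"
    using assms E by (intro ip_proj_left diff_mem proj_mem)
  also have "\<dots> = 0"
    using ip_resid_basis[OF assms] E assms(2)
    by (intro sum.neutral) (auto simp: ip_commute[of _ "f - proj E f"] diff_mem proj_mem subset_iff)
  finally show ?thesis .
qed

text \<open>Pythagoras, since \<open>f - proj E f\<close> is orthogonal to \<open>proj E f\<close>.
  The formula also shows that enlarging an orthonormal set never increases a residual.\<close>

lemma resid_eq:
  assumes "orthonormal E" "f \<in> H"
  shows "resid E f = ip f f - (\<Sum>e\<in>E. (ip f e)\<^sup>2)"
proof -
  note E = orthonormalD(2)[OF assms(1)]
  have "resid E f = ip (f - proj E f) f"
    unfolding resid_def using assms E ip_resid_proj[OF assms, of f]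
    by (subst ip_diff_right) (auto intro: diff_mem proj_mem)
  also have "\<dots> = ip f f - (\<Sum>e\<in>E. ip f e * ip e f)"
    using assms E by (simp add: ip_diff_left proj_mem ip_proj_left)
  also have "(\<Sum>e\<in>E. ip f e * ip e f) = (\<Sum>e\<in>E. (ip f e)\<^sup>2)"
    using assms E by (intro sum.cong) (auto simp: power2_eq_square ip_commute)
  finally show ?thesis .
qed

lemma resid_nonneg: "E \<subseteq> H \<Longrightarrow> f \<in> H \<Longrightarrow> 0 \<le> resid E f"
  unfolding resid_def by (intro ip_nonneg diff_mem proj_mem)

text \<open>The map from \<open>f\<close> to \<open>f - proj E f\<close> is linear, and
  \<open>null_ip\<close> makes null functions closed under sums. This carries
  \<open>resid E b = 0\<close> from generators to their span.\<close>

lemma subspace_resid_zero: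
  assumes "E \<subseteq> H"
  shows "fun_vs.subspace {f \<in> H. resid E f = 0}"
proof (rule fun_vs.subspaceI)
  have "proj E 0 = 0"
    using proj_scale[OF assms zero_mem, of 0] by (simp add: fun_eq_iff zero_fun_def)
  then show "0 \<in> {f \<in> H. resid E f = 0}"
    by (simp add: zero_mem resid_def ip_zero_left)
next
  fix f g assume "f \<in> {f \<in> H. resid E f = 0}" "g \<in> {f \<in> H. resid E f = 0}"
  then have fg: "f \<in> H" "g \<in> H" "resid E f = 0" "resid E g = 0" by auto
  define u v where "u = f - proj E f" and "v = g - proj E g"
  have uv: "u \<in> H" "v \<in> H" "ip u u = 0" "ip v v = 0"
    using fg assms by (auto simp: u_def v_def resid_def diff_mem proj_mem)
  have "f + g - proj E (f + g) = u + v"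
    using fg assms by (simp add: proj_add u_def v_def)
  then have "resid E (f + g) = 0"
    unfolding resid_def using uv null_ip[OF uv(1,3,2)]
    by (simp add: ip_add_left ip_add_right add_mem)
  then show "f + g \<in> {f \<in> H. resid E f = 0}" using fg by (simp add: add_mem)
next
  fix c f assume "f \<in> {f \<in> H. resid E f = 0}"
  then have f: "f \<in> H" "resid E f = 0" by auto
  define u where "u = f - proj E f"
  have u: "u \<in> H" "ip u u = 0"
    using f assms by (auto simp: u_def resid_def diff_mem proj_mem)
  have "(\<lambda>x. c * f x) - proj E (\<lambda>x. c * f x) = (\<lambda>x. c * u x)"
    using f assms by (simp add: proj_scale u_def fun_eq_iff algebra_simps)
  then have "resid E (\<lambda>x. c * f x) = 0"
    unfolding resid_def using u by (simp add: ip_scale_left ip_scale_right scale_mem)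
  then show "(\<lambda>x. c * f x) \<in> {f \<in> H. resid E f = 0}" using f by (simp add: scale_mem)
qed

text \<open>Each new vector contributes its normalized residual. Vectors of \<open>span B\<close>
  may differ from \<open>span E\<close> by a null function, hence the conclusion
  \<open>resid E f = 0\<close> in place of membership in \<open>span E\<close>.\<close>

lemma Gram_Schmidt:
  assumes "finite B" "B \<subseteq> H"
  obtains E where "orthonormal E" "E \<subseteq> fun_vs.span B" "card E \<le> card B"
    "\<And>f. f \<in> fun_vs.span B \<Longrightarrow> f \<in> H \<and> resid E f = 0"
proof -
  have "\<exists>E. orthonormal E \<and> E \<subseteq> fun_vs.span B \<and> card E \<le> card B \<and> (\<forall>b\<in>B. resid E b = 0)"
    using assms
  proof (induction B rule: finite_induct)
    case empty
    then show ?case by (intro exI[of _ "{}"]) (simp add: orthonormal_def)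
  next
    case (insert b B)
    then obtain E where E: "orthonormal E" "E \<subseteq> fun_vs.span B" "card E \<le> card B"
      "\<forall>b\<in>B. resid E b = 0"
      by auto
    note on = orthonormalD[OF E(1)]
    have b: "b \<in> H" "B \<subseteq> H" using insert.prems by auto
    have mono: "fun_vs.span B \<subseteq> fun_vs.span (insert b B)"
      by (intro fun_vs.span_mono) auto
    show ?case
    proof (cases "resid E b = 0")
      \<comment> \<open>A null residual cannot be normalized, so \<open>E\<close> is kept; this is
        why \<open>card E\<close> may be smaller than \<open>card B\<close>.\<close>
      case True
      then show ?thesis using E mono insert.hyps by (intro exI[of _ E]) auto
    next
      case False
      define r where "r = b - proj E b"
      define a where "a = 1 / sqrt (ip r r)"
      define e where "e = (\<lambda>x. a * r x)"
      have r: "r \<in> H" "ip r r > 0"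
        using False resid_nonneg[OF on(2) b(1)] b on(2)
        by (auto simp: r_def resid_def diff_mem proj_mem)
      have e: "e \<in> H" unfolding e_def using r by (intro scale_mem)
      have ee: "ip e e = 1"
        using r by (simp add: e_def ip_scale_left ip_scale_right scale_mem) (simp add: a_def)
      have re: "ip r e = sqrt (ip r r)"
        using r by (simp add: e_def ip_scale_right) (simp add: a_def real_div_sqrt)
      have eE: "ip e e' = 0" if "e' \<in> E" for e'
      proof -
        have "ip r e' = 0" unfolding r_def by (rule ip_resid_basis[OF E(1) b(1) that])
        then show ?thesis using r(1) that on(2) by (auto simp: e_def ip_scale_left)
      qed
      have Ee: "ip e' e = 0" if "e' \<in> E" for e'
        using eE[OF that] ip_commute[OF e, of e'] that on(2) by auto
      have "e \<notin> E" using eE ee by force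
      have on': "orthonormal (insert e E)"
        using on(1,2) E(1) e ee eE Ee \<open>e \<notin> E\<close> by (auto simp: orthonormal_def)
      note on'' = orthonormalD[OF on']
      have "E \<subseteq> fun_vs.span (insert b B)" using E(2) mono by auto
      then have "fun_vs.span E \<subseteq> fun_vs.span (insert b B)"
        by (intro fun_vs.span_minimal fun_vs.subspace_span)
      then have "r \<in> fun_vs.span (insert b B)"
        unfolding r_def using proj_span[of E b] fun_vs.span_base[of b "insert b B"]
        by (intro fun_vs.span_diff) auto
      then have "e \<in> fun_vs.span (insert b B)"
        unfolding e_def by (rule fun_vs.span_scale)
      with \<open>E \<subseteq> fun_vs.span (insert b B)\<close>
      have "insert e E \<subseteq> fun_vs.span (insert b B)" by auto
      moreover have "resid (insert e E) b = 0"
      proof -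
        have "ip b e = sqrt (ip r r)"
        proof -
          have "ip (proj E b) e = 0"
            using Ee e on(2) by (simp add: ip_proj_left)
          then show ?thesis
            using re b e on(2) by (simp add: r_def ip_diff_left proj_mem)
        qed
        \<comment> \<open>By \<open>resid_eq\<close>, the new vector lowers the residual of
          \<open>b\<close> by the square of \<open>ip b e\<close>, which is all of it.\<close>
        then have "resid (insert e E) b = resid E b - ip r r"
          using r \<open>e \<notin> E\<close> on by (simp add: resid_eq[OF on' b(1)] resid_eq[OF E(1) b(1)])
        then show ?thesis by (simp add: resid_def r_def)
      qed
      moreover have "resid (insert e E) b' = 0" if "b' \<in> B" for b'
      proof -
        have b': "b' \<in> H" "resid E b' = 0" using b E that by auto
        have "resid (insert e E) b' \<le> resid E b'"
          using \<open>e \<notin> E\<close> on by (simp add: resid_eq[OF on' b'(1)] resid_eq[OF E(1) b'(1)])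
        then show ?thesis using b' resid_nonneg[OF on''(2) b'(1)] by simp
      qed
      ultimately show ?thesis
        using on' on E(3) \<open>e \<notin> E\<close> insert.hyps by (intro exI[of _ "insert e E"]) auto
    qed
  qed
  then obtain E where E: "orthonormal E" "E \<subseteq> fun_vs.span B" "card E \<le> card B"
    "\<forall>b\<in>B. resid E b = 0"
    by auto
  have "fun_vs.span B \<subseteq> {f \<in> H. resid E f = 0}"
    using E assms by (intro fun_vs.span_minimal subspace_resid_zero) (auto dest: orthonormalD)
  then show ?thesis using that[of E] E by auto
qed

text \<open>Since \<open>f\<close> agrees with its projection up to a null function,
  \<open>u\<close> and \<open>u - f\<close> have the same residual, and by Pythagoras a residual is
  at most the squared norm.\<close>

lemma resid_le_dist:
  assumes E: "orthonormal E" and u: "u \<in> H" and f: "f \<in> H" "resid E f = 0"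
  shows "resid E u \<le> ip (u - f) (u - f)"
proof -
  note on = orthonormalD[OF E]
  have uf: "u - f \<in> H" using u f by (intro diff_mem)
  define p q where "p = u - proj E u" and "q = f - proj E f"
  have pq: "p \<in> H" "q \<in> H" "ip q q = 0"
    using u f on(2) by (auto simp: p_def q_def resid_def diff_mem proj_mem)
  have "(u - f) - proj E (u - f) = p - q"
    using u f on(2) by (simp add: proj_diff p_def q_def algebra_simps)
  then have "resid E (u - f) = ip p p"
    unfolding resid_def using pq null_ip[OF pq(2,3,1)]
    by (simp add: ip_diff_left ip_diff_right diff_mem)
  also have "\<dots> = resid E u" by (simp add: resid_def p_def)
  finally have "resid E u = resid E (u - f)" ..
  also have "\<dots> \<le> ip (u - f) (u - f)"
    by (simp add: resid_eq[OF E uf] sum_nonneg)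
  finally show ?thesis .
qed

text \<open>Unit vectors that are close on average to a space of dimension at most
  \<open>card B\<close> keep most of their squared norm under projection onto it. Each basis vector
  accounts for at most \<open>c\<close> of the total, so many basis vectors are needed.\<close>

lemma approx_card_bound:
  fixes u f :: "'i \<Rightarrow> 'a \<Rightarrow> real"
  assumes I: "finite I" and B: "finite B"
    and u: "\<And>i. i \<in> I \<Longrightarrow> u i \<in> H" "\<And>i. i \<in> I \<Longrightarrow> ip (u i) (u i) = 1"
    and f: "\<And>i. i \<in> I \<Longrightarrow> f i \<in> H" "\<And>i. i \<in> I \<Longrightarrow> f i \<in> fun_vs.span B"
    and err: "(\<Sum>i\<in>I. ip (u i - f i) (u i - f i)) \<le> real (card I) * eps"
    and c: "\<And>\<phi>. \<phi> \<in> H \<Longrightarrow> ip \<phi> \<phi> = 1 \<Longrightarrow> (\<Sum>i\<in>I. (ip (u i) \<phi>)\<^sup>2) \<le> c" "0 \<le> c"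
  shows "real (card I) * (1 - eps) \<le> real (card B) * c"
proof -
  \<comment> \<open>Elements of \<open>B\<close> may lie outside \<open>H\<close>, where
    \<open>ip\<close> is not controlled. A maximal independent subset of the \<open>f i\<close> lies
    in \<open>H\<close> and, by the exchange lemma, is no larger than \<open>B\<close>.\<close>
  obtain C where C: "C \<subseteq> f ` I" "fun_vs.independent C" "f ` I \<subseteq> fun_vs.span C"
    using fun_vs.maximal_independent_subset[of "f ` I"] by blast
  have "finite C \<and> card C \<le> card B"
    using B C f(2) by (intro fun_vs.independent_span_bound) auto
  moreover have "C \<subseteq> H" using C f(1) by auto
  ultimately obtain E where E: "orthonormal E" "card E \<le> card C"
    "\<And>f. f \<in> fun_vs.span C \<Longrightarrow> f \<in> H \<and> resid E f = 0"
    using Gram_Schmidt[of C] by metis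
  note on = orthonormalD[OF E(1)]
  \<comment> \<open>The residual of \<open>u i\<close> is its squared distance to the span, hence at
    most the one to the particular point \<open>f i\<close>.\<close>
  have "real (card I) - (\<Sum>i\<in>I. \<Sum>e\<in>E. (ip (u i) e)\<^sup>2) = (\<Sum>i\<in>I. resid E (u i))"
    using u by (simp add: resid_eq[OF E(1)] sum_subtractf)
  also have "\<dots> \<le> (\<Sum>i\<in>I. ip (u i - f i) (u i - f i))"
    using u f C E by (intro sum_mono resid_le_dist) auto
  also note err
  finally have "real (card I) * (1 - eps) \<le> (\<Sum>i\<in>I. \<Sum>e\<in>E. (ip (u i) e)\<^sup>2)"
    by (simp add: algebra_simps)
  also have "\<dots> = (\<Sum>e\<in>E. \<Sum>i\<in>I. (ip (u i) e)\<^sup>2)" by (rule sum.swap)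
  also have "\<dots> \<le> (\<Sum>e\<in>E. c)" using on by (intro sum_mono c) auto
  also have "\<dots> \<le> real (card B) * c"
    using \<open>finite C \<and> card C \<le> card B\<close> E(2) c(2) by (auto intro!: mult_right_mono)
  finally show ?thesis .
qed

end

section \<open>The operator norm of a Gram matrix\<close>

lemma L2_set_scale: "L2_set (\<lambda>i. c * v i) I = \<bar>c\<bar> * L2_set v I"
  by (simp add: L2_set_def power_mult_distrib flip: sum_distrib_left)
     (simp add: real_sqrt_mult)

text \<open>A supremum of reals obeys its usual rules only on a bounded set. Entries of a vector in
  the unit ball have modulus at most 1, so the sum of the moduli of all matrix entries is a
  bound.\<close>

lemma mat_opnorm_bdd:
  assumes "finite I"
  shows "bdd_above ((\<lambda>v. L2_set (\<lambda>i. \<Sum>j\<in>I. A i j * v j) I) ` {v. L2_set v I \<le> 1})"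
proof (rule bdd_aboveI2)
  fix v assume v: "v \<in> {v. L2_set v I \<le> 1}"
  have vj: "\<bar>v j\<bar> \<le> 1" if "j \<in> I" for j
  proof -
    have "\<bar>v j\<bar> \<le> L2_set (\<lambda>j. \<bar>v j\<bar>) I" using assms that by (rule member_le_L2_set)
    also have "\<dots> = L2_set v I" by (simp add: L2_set_def)
    finally show ?thesis using v by simp
  qed
  have "L2_set (\<lambda>i. \<Sum>j\<in>I. A i j * v j) I \<le> (\<Sum>i\<in>I. \<bar>\<Sum>j\<in>I. A i j * v j\<bar>)"
    by (rule L2_set_le_sum_abs)
  also have "\<dots> \<le> (\<Sum>i\<in>I. \<Sum>j\<in>I. \<bar>A i j * v j\<bar>)"
    by (intro sum_mono sum_abs)
  also have "\<dots> \<le> (\<Sum>i\<in>I. \<Sum>j\<in>I. \<bar>A i j\<bar>)"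
    using vj by (intro sum_mono) (simp add: abs_mult mult_left_le)
  finally show "L2_set (\<lambda>i. \<Sum>j\<in>I. A i j * v j) I \<le> (\<Sum>i\<in>I. \<Sum>j\<in>I. \<bar>A i j\<bar>)" .
qed

lemma mat_opnorm_nonneg: "finite I \<Longrightarrow> 0 \<le> mat_opnorm I A"
  unfolding mat_opnorm_def
  by (rule cSUP_upper2[OF mat_opnorm_bdd, of _ "\<lambda>_. 0"]) (simp_all add: L2_set_0')

text \<open>By homogeneity: \<open>v\<close> is rescaled to length 1, unless it vanishes on
  \<open>I\<close>.\<close>

lemma mat_opnorm_bound:
  assumes "finite I"
  shows "L2_set (\<lambda>i. \<Sum>j\<in>I. A i j * v j) I \<le> mat_opnorm I A * L2_set v I"
proof (cases "L2_set v I = 0")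
  case True
  then have "\<forall>j\<in>I. v j = 0" using assms by (simp add: L2_set_eq_0_iff)
  then show ?thesis using True by (simp add: L2_set_0')
next
  case False
  then have pos: "L2_set v I > 0" using L2_set_nonneg[of v I] by linarith
  define c where "c = 1 / L2_set v I"
  have c: "c > 0" using pos by (simp add: c_def)
  have "L2_set (\<lambda>i. \<Sum>j\<in>I. A i j * (c * v j)) I \<le> mat_opnorm I A"
    unfolding mat_opnorm_def
    using pos L2_set_scale[of c v I] by (intro cSUP_upper mat_opnorm_bdd[OF assms]) (simp add: c_def)
  also have "(\<lambda>i. \<Sum>j\<in>I. A i j * (c * v j)) = (\<lambda>i. c * (\<Sum>j\<in>I. A i j * v j))"
    by (simp add: fun_eq_iff sum_distrib_left algebra_simps)
  finally show ?thesis
    using c pos by (simp only: L2_set_scale) (simp add: c_def pos_divide_le_eq)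
qed

context semi_inner
begin

text \<open>The inner products of \<open>u i\<close> with the combination \<open>t v\<close> form
  the Gram matrix applied to \<open>v\<close>. This translates between norms of the matrix and inner
  products in \<open>H\<close>.\<close>

lemma Gram_vector:
  assumes "\<And>i. i \<in> I \<Longrightarrow> u i \<in> H"
  defines "t v \<equiv> (\<Sum>j\<in>I. (\<lambda>x. v j * u j x))"
  shows "t v \<in> H"
    and "\<phi> \<in> H \<Longrightarrow> ip (t v) \<phi> = (\<Sum>j\<in>I. v j * ip (u j) \<phi>)"
    and "i \<in> I \<Longrightarrow> ip (u i) (t v) = (\<Sum>j\<in>I. ip (u i) (u j) * v j)"
proof -
  show t: "t v \<in> H" unfolding t_def using assms(1) by (intro sum_mem scale_mem)
  show *: "ip (t v) \<phi> = (\<Sum>j\<in>I. v j * ip (u j) \<phi>)" if "\<phi> \<in> H" for \<phi>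
    unfolding t_def using assms(1) that
    by (subst ip_sum_left) (auto simp: scale_mem ip_scale_left)
  assume i: "i \<in> I"
  then have "ip (u i) (t v) = (\<Sum>j\<in>I. v j * ip (u j) (u i))"
    using *[of "u i"] assms(1) t by (simp add: ip_commute[of "u i"])
  then show "ip (u i) (t v) = (\<Sum>j\<in>I. ip (u i) (u j) * v j)"
    using i assms(1) by (simp add: ip_commute[of "u i"] mult.commute)
qed

text \<open>Let \<open>w\<close> collect the inner products of \<open>\<phi>\<close> with the
  \<open>u i\<close>, let \<open>s\<close> be its squared length and \<open>t\<close> the
  combination with coefficients \<open>w\<close>. Then \<open>ip t \<phi> = s\<close>, so
  Cauchy-Schwarz bounds the square of \<open>s\<close> by \<open>ip t t * ip \<phi> \<phi>\<close>.
  As \<open>ip t t\<close> is the quadratic form of the Gram matrix at \<open>w\<close>, it is at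
  most \<open>N * s\<close>, and one factor \<open>s\<close> cancels.\<close>

lemma sum_ip_squares_le_opnorm:
  assumes I: "finite I" and u: "\<And>i. i \<in> I \<Longrightarrow> u i \<in> H" and \<phi>: "\<phi> \<in> H"
  shows "(\<Sum>i\<in>I. (ip (u i) \<phi>)\<^sup>2) \<le> mat_opnorm I (\<lambda>i j. ip (u i) (u j)) * ip \<phi> \<phi>"
proof -
  define N where "N = mat_opnorm I (\<lambda>i j. ip (u i) (u j))"
  define w where "w i = ip (u i) \<phi>" for i
  define s where "s = (\<Sum>i\<in>I. (w i)\<^sup>2)"
  define t where "t = (\<Sum>j\<in>I. (\<lambda>x. w j * u j x))"
  define \<Gamma>w where "\<Gamma>w = (\<lambda>i. \<Sum>j\<in>I. ip (u i) (u j) * w j)"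
  have t: "t \<in> H" unfolding t_def using u by (rule Gram_vector(1))
  have t_left: "ip t \<psi> = (\<Sum>j\<in>I. w j * ip (u j) \<psi>)" if "\<psi> \<in> H" for \<psi>
    unfolding t_def using u that by (rule Gram_vector(2))
  have t_right: "ip (u i) t = (\<Sum>j\<in>I. ip (u i) (u j) * w j)" if "i \<in> I" for i
    unfolding t_def using u that by (rule Gram_vector(3))
  have N: "0 \<le> N" unfolding N_def using I by (rule mat_opnorm_nonneg)
  have L: "L2_set w I * L2_set w I = s"
    by (simp add: s_def L2_set_def sum_nonneg)
  have "ip t \<phi> = s"
    using t_left[OF \<phi>] by (simp add: s_def w_def power2_eq_square)
  then have 1: "s\<^sup>2 \<le> ip t t * ip \<phi> \<phi>"
    using Cauchy_Schwarz[OF t \<phi>] by simp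
  have "ip t t = (\<Sum>i\<in>I. w i * \<Gamma>w i)"
    using t_left[OF t] t_right by (simp add: \<Gamma>w_def)
  also have "\<dots> \<le> (\<Sum>i\<in>I. \<bar>w i\<bar> * \<bar>\<Gamma>w i\<bar>)"
    by (intro sum_mono) (metis abs_ge_self abs_mult)
  also have "\<dots> \<le> L2_set w I * L2_set \<Gamma>w I" by (rule L2_set_mult_ineq)
  also have "\<dots> \<le> L2_set w I * (N * L2_set w I)"
    unfolding \<Gamma>w_def N_def by (intro mult_left_mono mat_opnorm_bound I L2_set_nonneg)
  also have "\<dots> = N * s" using L by (simp add: algebra_simps)
  finally have "ip t t * ip \<phi> \<phi> \<le> N * s * ip \<phi> \<phi>"
    using ip_nonneg[OF \<phi>] by (rule mult_right_mono)
  with 1 have 2: "s * s \<le> s * (N * ip \<phi> \<phi>)" by (simp add: power2_eq_square algebra_simps)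
  have "s \<ge> 0" by (simp add: s_def sum_nonneg)
  then have "s \<le> N * ip \<phi> \<phi>"
    using 2 N ip_nonneg[OF \<phi>] by (cases "s = 0") auto
  then show ?thesis by (simp add: s_def w_def N_def)
qed

text \<open>The converse estimate, tested at the combination \<open>t\<close> with coefficients
  \<open>v\<close>. The hypothesis gives \<open>s \<le> c * ip t t\<close> for the squared length
  \<open>s\<close> of the image of \<open>v\<close>, while \<open>ip t t \<le> sqrt s\<close>
  because \<open>v\<close> lies in the unit ball. Hence \<open>sqrt s \<le> c\<close>.\<close>

lemma opnorm_Gram_le:
  assumes I: "finite I" and u: "\<And>i. i \<in> I \<Longrightarrow> u i \<in> H"
    and c: "\<And>\<phi>. \<phi> \<in> H \<Longrightarrow> ip \<phi> \<phi> = 1 \<Longrightarrow> (\<Sum>i\<in>I. (ip (u i) \<phi>)\<^sup>2) \<le> c" "0 \<le> c"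
  shows "mat_opnorm I (\<lambda>i j. ip (u i) (u j)) \<le> c"
  unfolding mat_opnorm_def
proof (rule cSUP_least)
  show "{v. L2_set v I \<le> 1} \<noteq> {}"
    by (auto intro!: exI[of _ "\<lambda>_. 0"] simp: L2_set_0')
next
  fix v assume "v \<in> {v. L2_set v I \<le> 1}"
  then have v: "L2_set v I \<le> 1" by simp
  define t where "t = (\<Sum>j\<in>I. (\<lambda>x. v j * u j x))"
  define \<Gamma>v where "\<Gamma>v = (\<lambda>i. \<Sum>j\<in>I. ip (u i) (u j) * v j)"
  have t: "t \<in> H" unfolding t_def using u by (rule Gram_vector(1))
  have t_left: "ip t \<psi> = (\<Sum>j\<in>I. v j * ip (u j) \<psi>)" if "\<psi> \<in> H" for \<psi>
    unfolding t_def using u that by (rule Gram_vector(2))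
  have t_right: "ip (u i) t = (\<Sum>j\<in>I. ip (u i) (u j) * v j)" if "i \<in> I" for i
    unfolding t_def using u that by (rule Gram_vector(3))
  define s where "s = (\<Sum>i\<in>I. (ip (u i) t)\<^sup>2)"
  have L: "L2_set \<Gamma>v I = sqrt s"
    using t_right by (simp add: L2_set_def \<Gamma>v_def s_def)
  have s0: "0 \<le> s" by (simp add: s_def sum_nonneg)
  have 1: "s \<le> c * ip t t"
  proof (cases "ip t t = 0")
    case True
    then have "s = 0" using null_ip(2)[OF t] u by (simp add: s_def)
    then show ?thesis using True by simp
  next
    case False
    then have p: "ip t t > 0" using ip_nonneg[OF t] by simp
    \<comment> \<open>The bound \<open>c\<close> is available for unit vectors only, so
      \<open>t\<close> is normalized.\<close>
    define a where "a = 1 / sqrt (ip t t)"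
    have a2: "a\<^sup>2 = 1 / ip t t" using p by (simp add: a_def power_divide)
    have "(\<Sum>i\<in>I. (ip (u i) (\<lambda>x. a * t x))\<^sup>2) \<le> c"
    proof (rule c(1))
      show "(\<lambda>x. a * t x) \<in> H" using t by (rule scale_mem)
      have "ip (\<lambda>x. a * t x) (\<lambda>x. a * t x) = a\<^sup>2 * ip t t"
        using t by (simp add: ip_scale_left ip_scale_right scale_mem power2_eq_square)
      then show "ip (\<lambda>x. a * t x) (\<lambda>x. a * t x) = 1" using a2 p by simp
    qed
    also have "(\<Sum>i\<in>I. (ip (u i) (\<lambda>x. a * t x))\<^sup>2) = a\<^sup>2 * s"
      using u t by (simp add: ip_scale_right s_def sum_distrib_left power_mult_distrib)
    finally show ?thesis using a2 p by (simp add: field_simps)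
  qed
  have "ip t t = (\<Sum>i\<in>I. v i * \<Gamma>v i)"
    using t_left[OF t] t_right by (simp add: \<Gamma>v_def)
  also have "\<dots> \<le> (\<Sum>i\<in>I. \<bar>v i\<bar> * \<bar>\<Gamma>v i\<bar>)"
    by (intro sum_mono) (metis abs_ge_self abs_mult)
  also have "\<dots> \<le> L2_set v I * L2_set \<Gamma>v I" by (rule L2_set_mult_ineq)
  also have "\<dots> \<le> 1 * sqrt s"
    unfolding L using v s0 by (intro mult_right_mono) auto
  finally have "c * ip t t \<le> c * sqrt s" using c(2) by (simp add: mult_left_mono)
  with 1 have "sqrt s * sqrt s \<le> sqrt s * c" using s0 by (simp add: algebra_simps)
  then have "sqrt s \<le> c"
    using s0 c(2) mult_left_le_imp_le[of "sqrt s" "sqrt s" c] by (cases "s = 0") auto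
  then show "L2_set (\<lambda>i. \<Sum>j\<in>I. ip (u i) (u j) * v j) I \<le> c"
    using L by (simp add: \<Gamma>v_def)
qed

end

section \<open>Square-integrable functions under an invariant measure\<close>

lemma L2D:
  assumes "f \<in> L2 M"
  shows "f \<in> borel_measurable M" "integrable M (\<lambda>x. (f x)\<^sup>2)"
  using assms by (auto simp: L2_def)

lemma integrable_mult_L2:
  assumes "f \<in> L2 M" "g \<in> L2 M"
  shows "integrable M (\<lambda>x. f x * g x)"
proof (rule Bochner_Integration.integrable_bound)
  note [measurable] = L2D(1)[OF assms(1)] L2D(1)[OF assms(2)]
  show "integrable M (\<lambda>x. (f x)\<^sup>2 + (g x)\<^sup>2)"
    using assms by (auto dest: L2D)
  show "(\<lambda>x. f x * g x) \<in> borel_measurable M" by measurable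
  have "\<bar>a * b\<bar> \<le> a\<^sup>2 + b\<^sup>2" for a b :: real
  proof -
    have "0 \<le> (\<bar>a\<bar> - \<bar>b\<bar>)\<^sup>2" "0 \<le> \<bar>a\<bar> * \<bar>b\<bar>" by simp_all
    then show ?thesis unfolding power2_diff abs_mult power2_abs by linarith
  qed
  then show "AE x in M. norm (f x * g x) \<le> norm ((f x)\<^sup>2 + (g x)\<^sup>2)"
    by (auto simp: abs_of_nonneg)
qed

lemma subspace_L2: "fun_vs.subspace (L2 M)"
proof (rule fun_vs.subspaceI)
  show "0 \<in> L2 M" by (simp add: L2_def zero_fun_def)
next
  fix f g assume fg: "f \<in> L2 M" "g \<in> L2 M"
  note [measurable] = L2D(1)[OF fg(1)] L2D(1)[OF fg(2)]
  have "integrable M (\<lambda>x. (f x)\<^sup>2 + (g x)\<^sup>2 + 2 * (f x * g x))"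
    using fg by (intro Bochner_Integration.integrable_add integrable_mult_right
        integrable_mult_L2) (auto dest: L2D)
  then have "integrable M (\<lambda>x. ((f + g) x)\<^sup>2)"
    by (simp add: power2_sum mult.assoc)
  moreover have "f + g \<in> borel_measurable M" unfolding plus_fun_def by measurable
  ultimately show "f + g \<in> L2 M" by (simp add: L2_def)
next
  fix c f assume "f \<in> L2 M"
  then show "(\<lambda>x. c * f x) \<in> L2 M" by (auto simp: L2_def power_mult_distrib)
qed

lemma semi_inner_L2: "semi_inner (L2 M) (l2_inner M)"
proof
  show "fun_vs.subspace (L2 M)" by (rule subspace_L2)
  show "l2_inner M f g = l2_inner M g f" for f g
    by (simp add: l2_inner_def mult.commute)
  show "l2_inner M (f + g) k = l2_inner M f k + l2_inner M g k"
    if "f \<in> L2 M" "g \<in> L2 M" "k \<in> L2 M" for f g k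
    using that by (simp add: l2_inner_def distrib_right integrable_mult_L2)
  show "l2_inner M (\<lambda>x. c * f x) g = c * l2_inner M f g" for c f g
    by (simp add: l2_inner_def mult.assoc)
  show "0 \<le> l2_inner M f f" for f
    by (simp add: l2_inner_def)
qed

lemma l2_norm_sq: "(l2_norm M f)\<^sup>2 = l2_inner M f f"
  by (simp add: l2_norm_def l2_inner_def)

lemma l2_inner_diff_commute: "l2_inner M (f - g) (f - g) = l2_inner M (g - f) (g - f)"
  by (simp add: l2_inner_def algebra_simps)

section \<open>Translations, alignment and the dimension bound\<close>

lemma translate_diff: "translate act g (f - k) = translate act g f - translate act g k"
  by (simp add: translate_def fun_eq_iff)

text \<open>Translation is linear, so the functions that it maps into a given span form a subspace,
  and generators suffice.\<close>

lemma translate_span: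
  assumes "\<And>b. b \<in> B \<Longrightarrow> translate act g b \<in> fun_vs.span C" "f \<in> fun_vs.span B"
  shows "translate act g f \<in> fun_vs.span C"
proof -
  have "fun_vs.subspace {f. translate act g f \<in> fun_vs.span C}"
  proof (rule fun_vs.subspaceI)
    have "translate act g 0 = 0" by (simp add: translate_def fun_eq_iff)
    then show "0 \<in> {f. translate act g f \<in> fun_vs.span C}" by (simp add: fun_vs.span_zero)
  next
    fix f k assume "f \<in> {f. translate act g f \<in> fun_vs.span C}"
      "k \<in> {f. translate act g f \<in> fun_vs.span C}"
    moreover have "translate act g (f + k) = translate act g f + translate act g k"
      by (simp add: translate_def fun_eq_iff)
    ultimately show "f + k \<in> {f. translate act g f \<in> fun_vs.span C}"
      by (simp add: fun_vs.span_add)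
  next
    fix c f assume "f \<in> {f. translate act g f \<in> fun_vs.span C}"
    then have "(\<lambda>x. c * translate act g f x) \<in> fun_vs.span C"
      by (auto intro: fun_vs.span_scale)
    then show "(\<lambda>x. c * f x) \<in> {f. translate act g f \<in> fun_vs.span C}"
      by (simp add: translate_def comp_def)
  qed
  then have "fun_vs.span B \<subseteq> {f. translate act g f \<in> fun_vs.span C}"
    using assms(1) by (intro fun_vs.span_minimal) auto
  then show ?thesis using assms(2) by auto
qed

lemma translate_L2:
  assumes "invariant_measure G act M" "g \<in> carrier G" "f \<in> L2 M"
  shows "translate act g f \<in> L2 M"
proof -
  have act: "act g \<in> measurable M M" "distr M M (act g) = M"
    using assms by (auto simp: invariant_measure_def)
  have "integrable M (\<lambda>x. (f (act g x))\<^sup>2)"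
    using L2D[OF assms(3)] act integrable_distr[of "act g" M M "\<lambda>x. (f x)\<^sup>2"] by simp
  then show ?thesis
    using act L2D[OF assms(3)] by (auto simp: L2_def translate_def comp_def)
qed

text \<open>Change of variables under the invariant measure: translations are isometries.\<close>

lemma l2_inner_translate:
  assumes "invariant_measure G act M" "g \<in> carrier G" "f \<in> L2 M" "k \<in> L2 M"
  shows "l2_inner M (translate act g f) (translate act g k) = l2_inner M f k"
proof -
  have act: "act g \<in> measurable M M" "distr M M (act g) = M"
    using assms by (auto simp: invariant_measure_def)
  note [measurable] = L2D(1)[OF assms(3)] L2D(1)[OF assms(4)]
  show ?thesis
    using integral_distr[OF act(1), of "\<lambda>x. f x * k x"] act(2)
    by (simp add: l2_inner_def translate_def)
qed

text \<open>Up to the factor \<open>card (carrier G)\<close>, the alignment is the supremum over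
  unit \<open>\<phi>\<close> of the sum of squared inner products with the translates. The two
  preceding estimates on Gram matrices bound it from above and from below; this is the equality of
  the norms of an operator composed with its adjoint in either order.\<close>

lemma alignment_eq_opnorm:
  assumes fin: "finite (carrier G)" "carrier G \<noteq> {}" and inv: "invariant_measure G act M"
    and h: "h \<in> L2 M" "l2_norm M h = 1"
  shows "alignment G act M h
    = mat_opnorm (carrier G) (gram act M h) / real (card (carrier G))"
proof -
  interpret L2: semi_inner "L2 M" "l2_inner M" by (rule semi_inner_L2)
  define I where "I = carrier G"
  define u where "u g = translate act g h" for g
  define N where "N = mat_opnorm I (gram act M h)"
  define S where "S = {\<phi> \<in> L2 M. l2_norm M \<phi> = 1}"
  have u: "u g \<in> L2 M" if "g \<in> I" for g
    using translate_L2[OF inv _ h(1)] that by (simp add: u_def I_def)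
  have S: "\<phi> \<in> S \<longleftrightarrow> \<phi> \<in> L2 M \<and> l2_inner M \<phi> \<phi> = 1" for \<phi>
    by (simp add: S_def l2_norm_def)
  have card: "real (card I) > 0" using fin by (auto simp: I_def card_gt_0_iff)
  have gram: "gram act M h = (\<lambda>g g'. l2_inner M (u g) (u g'))"
    by (simp add: fun_eq_iff gram_def u_def)
  have al: "alignment G act M h = (SUP \<phi>\<in>S. (\<Sum>g\<in>I. (l2_inner M (u g) \<phi>)\<^sup>2) / real (card I))"
    using fin by (simp add: alignment_def S_def u_def I_def integral_pmf_of_set)
  have le: "(\<Sum>g\<in>I. (l2_inner M (u g) \<phi>)\<^sup>2) \<le> N" if "\<phi> \<in> S" for \<phi>
    using L2.sum_ip_squares_le_opnorm[of I u \<phi>] fin u that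
    by (simp add: S N_def gram I_def)
  have bdd: "bdd_above ((\<lambda>\<phi>. (\<Sum>g\<in>I. (l2_inner M (u g) \<phi>)\<^sup>2) / real (card I)) ` S)"
    using le card by (intro bdd_aboveI2[of _ _ "N / real (card I)"] divide_right_mono) auto
  have hS: "h \<in> S" using h by (simp add: S_def)
  have al_ge: "(\<Sum>g\<in>I. (l2_inner M (u g) \<phi>)\<^sup>2) \<le> alignment G act M h * real (card I)"
    if "\<phi> \<in> S" for \<phi>
    using cSUP_upper[OF that bdd] card unfolding al by (simp add: pos_divide_le_eq)
  have "N \<le> alignment G act M h * real (card I)"
    unfolding N_def gram
  proof (rule L2.opnorm_Gram_le)
    show "finite I" using fin by (simp add: I_def)
    \<comment> \<open>The alignment dominates the value at \<open>\<phi> = h\<close>, which is a sum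
      of squares.\<close>
    show "0 \<le> alignment G act M h * real (card I)"
      using al_ge[OF hS] by (rule order_trans[rotated]) (simp add: sum_nonneg)
  qed (use u al_ge S in auto)
  moreover have "alignment G act M h \<le> N / real (card I)"
    unfolding al using hS le card by (intro cSUP_least divide_right_mono) auto
  ultimately show ?thesis
    using card by (simp add: N_def I_def field_simps)
qed

text \<open>This is \<open>approx_card_bound\<close> for the translates of \<open>h\<close>, with
  the operator norm as \<open>c\<close>. The approximants \<open>f g\<close> are arbitrary because
  later they are either translates of one output or translated outputs of different samples.\<close>

lemma dimension_bound:
  assumes fin: "finite (carrier G)" "finite B" and inv: "invariant_measure G act M"
    and h: "h \<in> L2 M" "l2_norm M h = 1"
    and f: "\<And>g. g \<in> carrier G \<Longrightarrow> f g \<in> L2 M" "\<And>g. g \<in> carrier G \<Longrightarrow> f g \<in> fun_vs.span B"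
    and err: "(\<Sum>g\<in>carrier G. (l2_norm M (f g - translate act g h))\<^sup>2)
      \<le> real (card (carrier G)) * eps"
  shows "real (card (carrier G)) / mat_opnorm (carrier G) (gram act M h) * (1 - eps)
    \<le> real (card B)"
proof -
  interpret L2: semi_inner "L2 M" "l2_inner M" by (rule semi_inner_L2)
  define u where "u g = translate act g h" for g
  define N where "N = mat_opnorm (carrier G) (gram act M h)"
  have N: "0 \<le> N" unfolding N_def using fin(1) by (rule mat_opnorm_nonneg)
  have gram: "gram act M h = (\<lambda>g g'. l2_inner M (u g) (u g'))"
    by (simp add: fun_eq_iff gram_def u_def)
  have u: "u g \<in> L2 M" if "g \<in> carrier G" for g
    using translate_L2[OF inv that h(1)] by (simp add: u_def)
  have "real (card (carrier G)) * (1 - eps) \<le> real (card B) * N"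
  proof (rule L2.approx_card_bound[OF fin, where u = u and f = f])
    show "l2_inner M (u g) (u g) = 1" if "g \<in> carrier G" for g
      using l2_inner_translate[OF inv that h(1,1)] h(2) by (simp add: u_def l2_norm_def)
    show "(\<Sum>g\<in>carrier G. l2_inner M (u g - f g) (u g - f g))
      \<le> real (card (carrier G)) * eps"
      using err by (simp add: l2_norm_sq u_def l2_inner_diff_commute[of M "translate _ _ _"])
    show "(\<Sum>g\<in>carrier G. (l2_inner M (u g) \<phi>)\<^sup>2) \<le> N"
      if "\<phi> \<in> L2 M" "l2_inner M \<phi> \<phi> = 1" for \<phi>
      using L2.sum_ip_squares_le_opnorm[of "carrier G" u \<phi>] fin u that by (simp add: N_def gram)
  qed (use u f N in auto)
  \<comment> \<open>For \<open>N = 0\<close> the quotient is 0 by the convention for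
    division.\<close>
  then show ?thesis
    using N by (cases "N = 0") (auto simp: N_def[symmetric] field_simps)
qed

section \<open>Kernel methods\<close>

text \<open>If some finite set spans \<open>H\<close>, a basis is a spanning set of size
  \<open>dim H\<close>; otherwise the right-hand side is infinite.\<close>

lemma le_fun_dimI:
  assumes "\<And>B. finite B \<Longrightarrow> H \<subseteq> fun_vs.span B \<Longrightarrow> b \<le> real (card B)"
  shows "ereal b \<le> ereal_of_enat (fun_dim H)"
proof (cases "\<exists>B. finite B \<and> H \<subseteq> fun_vs.span B")
  case True
  then obtain T where T: "finite T" "H \<subseteq> fun_vs.span T" by auto
  obtain B where B: "B \<subseteq> H" "fun_vs.independent B" "H \<subseteq> fun_vs.span B"
    "card B = fun_vs.dim H"
    by (rule fun_vs.basis_exists)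
  have "finite B" using fun_vs.independent_span_bound[of T B] T B by auto
  then show ?thesis using assms[of B] B True by (simp add: fun_dim_def)
next
  case False
  then have "fun_dim H = \<infinity>" unfolding fun_dim_def by (rule if_not_P)
  then show ?thesis by simp
qed

lemma semi_inner_rkhs:
  assumes "is_rkhs K H ip"
  shows "semi_inner H ip"
  using assms unfolding is_rkhs_def is_inner_product_def by unfold_locales auto

text \<open>The component of a minimizer orthogonal to the kernel sections at the sample points
  vanishes at these points. It leaves the loss unchanged and costs \<open>lam\<close> times its
  squared norm, so minimality forces it to be 0.\<close>

lemma representer:
  assumes rkhs: "is_rkhs K H ip" and "lam > 0"
    and ex: "\<exists>f. is_arg_min (reg_risk ip l lam S) (\<lambda>f. f \<in> H) f"
  shows "kernel_method H ip l lam S \<in> fun_vs.span (K ` fst ` set S)"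
proof -
  interpret semi_inner H ip using rkhs by (rule semi_inner_rkhs)
  have K: "\<And>x. K x \<in> H" "\<And>f x. f \<in> H \<Longrightarrow> ip f (K x) = f x"
    and definite: "\<And>f. f \<in> H \<Longrightarrow> ip f f = 0 \<Longrightarrow> f = 0"
    using rkhs by (auto simp: is_rkhs_def is_inner_product_def)
  define f where "f = kernel_method H ip l lam S"
  \<comment> \<open>\<open>arg_min\<close> is a choice operator, and existence makes its value a
    minimizer.\<close>
  have "is_arg_min (reg_risk ip l lam S) (\<lambda>f. f \<in> H) f"
    unfolding f_def kernel_method_def arg_min_def using ex by (rule someI_ex)
  then have f: "f \<in> H" "\<And>k. k \<in> H \<Longrightarrow> reg_risk ip l lam S f \<le> reg_risk ip l lam S k"
    by (auto simp: is_arg_min_def not_less)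
  obtain E where E: "orthonormal E" "E \<subseteq> fun_vs.span (K ` fst ` set S)"
    "\<And>k. k \<in> fun_vs.span (K ` fst ` set S) \<Longrightarrow> k \<in> H \<and> resid E k = 0"
    using Gram_Schmidt[of "K ` fst ` set S"] K(1) by (metis finite_imageI finite_set image_subsetI)
  note on = orthonormalD[OF E(1)]
  define p q where "p = proj E f" and "q = f - p"
  have pq: "p \<in> H" "q \<in> H" using on f by (auto simp: p_def q_def proj_mem diff_mem)
  have qp: "ip q (proj E k) = 0" for k
    unfolding q_def p_def by (rule ip_resid_proj[OF E(1) f(1)])
  have "p x = f x" if "x \<in> fst ` set S" for x
  proof -
    define r where "r = K x - proj E (K x)"
    have "K x \<in> fun_vs.span (K ` fst ` set S)"
      using that by (intro fun_vs.span_base) auto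
    then have "ip r r = 0" using E(3) by (simp add: resid_def r_def)
    moreover have "r \<in> H" using K(1) on(2) by (simp add: r_def diff_mem proj_mem)
    \<comment> \<open>Definiteness of the RKHS turns a null residual into an equality of
      functions.\<close>
    ultimately have "r = 0" using definite by blast
    then have "K x = proj E (K x)" by (simp add: r_def)
    then have "ip q (K x) = 0" using qp by metis
    then show ?thesis using K(2) pq by (simp add: q_def)
  qed
  then have same: "p (fst (S ! i)) = f (fst (S ! i))" if "i < length S" for i
    using that by simp
  have "f = p + q" by (simp add: q_def)
  moreover have "ip q p = 0" using qp by (simp add: p_def)
  ultimately have "ip f f = ip p p + ip q q"
    using pq ip_commute[of p q] by (simp add: ip_add_left ip_add_right add_mem)
  then have "reg_risk ip l lam S f = reg_risk ip l lam S p + lam * ip q q"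
    using same by (simp add: reg_risk_def algebra_simps)
  then have "ip q q \<le> 0" using f(2)[OF pq(1)] \<open>lam > 0\<close> by (simp add: mult_le_0_iff)
  then have "q = 0" using definite pq ip_nonneg[of q] by simp
  then have "f = p" by (simp add: q_def)
  moreover have "p \<in> fun_vs.span (K ` fst ` set S)"
    using proj_span[of E f] E(2) fun_vs.span_minimal[OF E(2) fun_vs.subspace_span]
    by (auto simp: p_def)
  ultimately show ?thesis by (simp add: f_def)
qed

section \<open>Lower bounds from an orbit of samples and from a single sample\<close>

lemma set_labelled: "fst ` set (labelled h xs) = set xs"
  by (force simp: labelled_def)

lemma kernel_method_labelled_span:
  assumes "is_rkhs K H ip" "lam > 0" "equivariant_kernel_method G act K H ip l lam"
  shows "kernel_method H ip l lam (labelled h xs) \<in> fun_vs.span (K ` set xs)"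
proof -
  have "\<exists>f. is_arg_min (reg_risk ip l lam (labelled h xs)) (\<lambda>f. f \<in> H) f"
    using assms(3) unfolding equivariant_kernel_method_def by blast
  from representer[OF assms(1,2) this] show ?thesis unfolding set_labelled .
qed

lemma l2_norm_translate_error:
  assumes inv: "invariant_measure G act M" "g \<in> carrier G" and fh: "f \<in> L2 M" "h \<in> L2 M"
  shows "(l2_norm M (translate act g f - translate act g h))\<^sup>2 = (l2_norm M (f - h))\<^sup>2"
proof -
  have "f - h \<in> L2 M" using subspace_L2 fh by (rule fun_vs.subspace_diff)
  then show ?thesis
    using l2_inner_translate[OF inv] by (simp add: l2_norm_sq flip: translate_diff)
qed

text \<open>The output on the sample moved by \<open>g\<close> is a combination of the sections
  \<open>K (act g x)\<close>. Composing with \<open>act g\<close> turns these into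
  \<open>K x\<close> by invariance of the kernel, so all translated outputs lie in one span with at
  most \<open>length xs\<close> generators.\<close>

lemma sample_size_bound:
  fixes K :: "'a \<Rightarrow> 'a \<Rightarrow> real"
  assumes fin: "finite (carrier G)" and inv: "invariant_measure G act M"
    and km: "is_rkhs K H ip" "lam > 0" "equivariant_kernel_method G act K H ip l lam"
    and h: "h \<in> L2 M" "l2_norm M h = 1"
  defines "A \<equiv> kernel_method H ip l lam"
  assumes mem: "\<And>g. g \<in> carrier G \<Longrightarrow> A (labelled h (map (act g) xs)) \<in> L2 M"
    and err: "(\<Sum>g\<in>carrier G. sq_error M A h (map (act g) xs)) \<le> real (card (carrier G)) * eps"
  shows "ereal (real (card (carrier G)) / mat_opnorm (carrier G) (gram act M h) * (1 - eps))
    \<le> ereal_of_enat (min (enat (length xs)) (fun_dim H))"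
    (is "ereal ?b \<le> _")
proof -
  define f where "f g = translate act g (A (labelled h (map (act g) xs)))" for g
  have fL2: "f g \<in> L2 M" if "g \<in> carrier G" for g
    unfolding f_def using inv that mem[OF that] by (rule translate_L2)
  have fspan: "f g \<in> fun_vs.span (K ` set xs)" if "g \<in> carrier G" for g
    unfolding f_def A_def
  proof (rule translate_span[OF _ kernel_method_labelled_span[OF km]])
    fix b assume "b \<in> K ` set (map (act g) xs)"
    then obtain x where x: "x \<in> set xs" "b = K (act g x)" by auto
    then have "translate act g b = K x"
      using km(3) that by (simp add: translate_def fun_eq_iff equivariant_kernel_method_def)
    then show "translate act g b \<in> fun_vs.span (K ` set xs)"
      using x by (auto intro: fun_vs.span_base)
  qed
  have err': "(\<Sum>g\<in>carrier G. (l2_norm M (f g - translate act g h))\<^sup>2)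
    \<le> real (card (carrier G)) * eps"
    using err mem l2_norm_translate_error[OF inv _ _ h(1)] by (simp add: f_def sq_error_def)
  \<comment> \<open>Applied below to the kernel sections of the sample and to an arbitrary finite
    set spanning \<open>H\<close>.\<close>
  have *: "?b \<le> real (card B)"
    if "finite B" "\<And>g. g \<in> carrier G \<Longrightarrow> f g \<in> fun_vs.span B" for B
    using dimension_bound[OF fin that(1) inv h fL2 that(2) err'] .
  have "?b \<le> real (card (K ` set xs))" using * fspan by simp
  also have "\<dots> \<le> real (length xs)"
    by (simp add: card_image_le[THEN order_trans] card_length)
  finally have "ereal ?b \<le> ereal_of_enat (enat (length xs))" by simp
  moreover have "ereal ?b \<le> ereal_of_enat (fun_dim H)"
  proof (rule le_fun_dimI)
    fix B assume B: "finite B" "H \<subseteq> fun_vs.span B"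
    have "K ` set xs \<subseteq> fun_vs.span B" using km(1) B(2) by (auto simp: is_rkhs_def)
    then have "fun_vs.span (K ` set xs) \<subseteq> fun_vs.span B"
      by (intro fun_vs.span_minimal fun_vs.subspace_span)
    then show "?b \<le> real (card B)" using * B(1) fspan by blast
  qed
  ultimately show ?thesis by (simp add: min_def)
qed

text \<open>All translates of a single output are used. They involve kernel sections at other points
  of the orbits, so they stay in \<open>H\<close> but not in the span belonging to the
  sample.\<close>

lemma rkhs_dimension_bound:
  fixes K :: "'a \<Rightarrow> 'a \<Rightarrow> real"
  assumes surj: "\<And>g. g \<in> carrier G \<Longrightarrow> surj (act g)"
    and fin: "finite (carrier G)" and inv: "invariant_measure G act M"
    and km: "is_rkhs K H ip" "lam > 0" "equivariant_kernel_method G act K H ip l lam"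
    and h: "h \<in> L2 M" "l2_norm M h = 1"
    and ach: "achieves M (kernel_method H ip l lam) h eps xs"
  shows "ereal (real (card (carrier G)) / mat_opnorm (carrier G) (gram act M h) * (1 - eps))
    \<le> ereal_of_enat (fun_dim H)"
proof (rule le_fun_dimI)
  fix B assume B: "finite B" "H \<subseteq> fun_vs.span B"
  define a where "a = kernel_method H ip l lam (labelled h xs)"
  have a: "a \<in> L2 M" "(l2_norm M (a - h))\<^sup>2 \<le> eps"
    using ach by (auto simp: achieves_def sq_error_def a_def)
  show "real (card (carrier G)) / mat_opnorm (carrier G) (gram act M h) * (1 - eps)
    \<le> real (card B)"
  proof (rule dimension_bound[OF fin B(1) inv h, where f = "\<lambda>g. translate act g a"])
    fix g assume g: "g \<in> carrier G"
    show "translate act g a \<in> L2 M" using inv g a(1) by (rule translate_L2)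
    show "translate act g a \<in> fun_vs.span B"
      unfolding a_def
    proof (rule translate_span[OF _ kernel_method_labelled_span[OF km]])
      fix b assume "b \<in> K ` set xs"
      \<comment> \<open>Writing the sample point as \<open>act g x\<close> makes the translate of
        its section equal to \<open>K x\<close>.\<close>
      then obtain x where x: "b = K (act g x)" using surj[OF g] by (metis imageE surjD)
      then have "translate act g b = K x"
        using km(3) g by (simp add: translate_def fun_eq_iff equivariant_kernel_method_def)
      then show "translate act g b \<in> fun_vs.span B"
        using km(1) B(2) by (auto simp: is_rkhs_def)
    qed
  next
    show "(\<Sum>g\<in>carrier G. (l2_norm M (translate act g a - translate act g h))\<^sup>2)
      \<le> real (card (carrier G)) * eps"
      using a l2_norm_translate_error[OF inv _ a(1) h(1)] by (simp add: mult_left_mono)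
  qed
qed

section \<open>Random samples\<close>

lemma distr_PiM_invariant:
  assumes "prob_space M" "act g \<in> measurable M M" "distr M M (act g) = M"
  shows "compose {..<n} (act g) \<in> measurable (\<Pi>\<^sub>M i\<in>{..<n}. M) (\<Pi>\<^sub>M i\<in>{..<n}. M)"
    and "distr (\<Pi>\<^sub>M i\<in>{..<n}. M) (\<Pi>\<^sub>M i\<in>{..<n}. M) (compose {..<n} (act g))
      = (\<Pi>\<^sub>M i\<in>{..<n::nat}. M)"
proof -
  note [measurable] = assms(2)
  show "compose {..<n} (act g) \<in> measurable (\<Pi>\<^sub>M i\<in>{..<n}. M) (\<Pi>\<^sub>M i\<in>{..<n}. M)"
    unfolding compose_def by measurable
  \<comment> \<open>\<open>compose {..<n} (act g)\<close> moves every coordinate and is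
    \<open>undefined\<close> at other indices, as the product space demands. Each coordinate law is
    preserved, hence so is their product.\<close>
  show "distr (\<Pi>\<^sub>M i\<in>{..<n}. M) (\<Pi>\<^sub>M i\<in>{..<n}. M) (compose {..<n} (act g))
    = (\<Pi>\<^sub>M i\<in>{..<n}. M)"
    using distr_PiM_finite_prob_space'[of "{..<n}" "\<lambda>_. M" "\<lambda>_. M" "act g"] assms by simp
qed

text \<open>Each \<open>T g\<close> preserves the law of the sample, so the errors at all translates
  have the same mean, and their sum has mean below \<open>card (carrier G) * eps\<close>. As
  \<open>G\<close> is finite, almost every sample has all its translated outputs in
  \<open>L2 M\<close>.\<close>

lemma achieves_iid_orbit_sample:
  assumes fin: "finite (carrier G)" "carrier G \<noteq> {}" and inv: "invariant_measure G act M"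
    and M: "prob_space M" and ach: "achieves_iid M A h eps n"
  obtains xs where "length xs = n"
    "\<And>g. g \<in> carrier G \<Longrightarrow> A (labelled h (map (act g) xs)) \<in> L2 M"
    "(\<Sum>g\<in>carrier G. sq_error M A h (map (act g) xs)) < real (card (carrier G)) * eps"
proof -
  define P where "P = (\<Pi>\<^sub>M i\<in>{..<n}. M)"
  define good where "good x \<longleftrightarrow> A (labelled h (map x [0..<n])) \<in> L2 M" for x
  define err where "err x = sq_error M A h (map x [0..<n])" for x
  define T where "T g = compose {..<n} (act g)" for g
  interpret P: prob_space P unfolding P_def using M by (intro prob_space_PiM)
  have T: "T g \<in> measurable P P" "distr P P (T g) = P" if "g \<in> carrier G" for g
    using distr_PiM_invariant[OF M, of act g n] inv that
    by (auto simp: T_def P_def invariant_measure_def)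
  have A: "AE x in P. good x" "integrable P err" "(\<integral>x. err x \<partial>P) < eps"
    using ach unfolding achieves_iid_def good_def err_def P_def by blast+
  have "AE x in P. good (T g x)" if "g \<in> carrier G" for g
    by (rule AE_distrD[OF T(1)[OF that], unfolded T(2)[OF that]]) (rule A(1))
  then have good: "AE x in P. \<forall>g\<in>carrier G. good (T g x)"
    using fin(1) by (simp add: AE_finite_all)
  have int: "integrable P (\<lambda>x. err (T g x))" "(\<integral>x. err (T g x) \<partial>P) = (\<integral>x. err x \<partial>P)"
    if "g \<in> carrier G" for g
    using T[OF that] A(2) integrable_distr[of "T g" P P err] integral_distr[of "T g" P P err]
    by auto
  have "(\<integral>x. (\<Sum>g\<in>carrier G. err (T g x)) \<partial>P) = real (card (carrier G)) * (\<integral>x. err x \<partial>P)"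
    using int by (simp add: Bochner_Integration.integral_sum)
  also have "\<dots> < real (card (carrier G)) * eps"
    using A(3) fin by (simp add: card_gt_0_iff)
  finally have lt: "(\<integral>x. (\<Sum>g\<in>carrier G. err (T g x)) \<partial>P) < real (card (carrier G)) * eps" .
  \<comment> \<open>Otherwise the sum would be at least the constant almost everywhere, and so would
    its mean.\<close>
  have "\<exists>x. (\<forall>g\<in>carrier G. good (T g x)) \<and>
    (\<Sum>g\<in>carrier G. err (T g x)) < real (card (carrier G)) * eps"
  proof (rule ccontr)
    assume "\<not> ?thesis"
    with good have "AE x in P. real (card (carrier G)) * eps \<le> (\<Sum>g\<in>carrier G. err (T g x))"
      by (auto elim!: eventually_mono simp: not_less)
    then have "real (card (carrier G)) * eps \<le> (\<integral>x. (\<Sum>g\<in>carrier G. err (T g x)) \<partial>P)"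
      using int by (intro P.integral_ge_const Bochner_Integration.integrable_sum) auto
    then show False using lt by simp
  qed
  then obtain x where x: "\<forall>g\<in>carrier G. good (T g x)"
    "(\<Sum>g\<in>carrier G. err (T g x)) < real (card (carrier G)) * eps"
    by auto
  have eq: "map (T g x) [0..<n] = map (act g) (map x [0..<n])" for g
    by (auto simp: T_def compose_def)
  show ?thesis
    using x unfolding good_def err_def eq by (intro that[of "map x [0..<n]"]) auto
qed

text \<open>The sample size is bounded under a guarantee in expectation or on a whole orbit of
  samples. A single sample yields the bound on the dimension only, in view of the point mass example
  given with \<open>achieves_iid\<close>.\<close>

theorem theorem3p4:
  fixes G :: "('g, 'b) monoid_scheme" and act :: "'g \<Rightarrow> 'a \<Rightarrow> 'a" and M :: "'a measure"
    and K :: "'a \<Rightarrow> 'a \<Rightarrow> real" and H :: "('a \<Rightarrow> real) set"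
    and ip :: "('a \<Rightarrow> real) \<Rightarrow> ('a \<Rightarrow> real) \<Rightarrow> real"
    and l :: "real \<Rightarrow> real \<Rightarrow> real" and lam eps :: real
    and A :: "('a \<times> real) list \<Rightarrow> 'a \<Rightarrow> real" and h :: "'a \<Rightarrow> real"
  assumes "group_action G UNIV act" and "finite (carrier G)"
    and "prob_space M" and "space M = UNIV" and "invariant_measure G act M"
    and "spd_kernel K" and "is_rkhs K H ip" and "lam > 0"
    and "equivariant_kernel_method G act K H ip l lam" and "A = kernel_method H ip l lam"
    and "eps > 0" and "h \<in> L2 M" and "l2_norm M h = 1"
  shows "let bound = real (card (carrier G)) / mat_opnorm (carrier G) (gram act M h) * (1 - eps) in
      bound = (1 - eps) / alignment G act M h \<and>
      (\<forall>n. achieves_iid M A h eps n \<longrightarrow>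
         ereal_of_enat (min (enat n) (fun_dim H)) \<ge> ereal bound) \<and>
      (\<forall>n xs. length xs = n \<and> (\<forall>g\<in>carrier G. achieves M A h eps (map (act g) xs)) \<longrightarrow>
         ereal_of_enat (min (enat n) (fun_dim H)) \<ge> ereal bound) \<and>
      (\<forall>xs. achieves M A h eps xs \<longrightarrow> ereal_of_enat (fun_dim H) \<ge> ereal bound)"
proof -
  interpret group_action G UNIV act by fact
  interpret group_hom G "BijGroup UNIV" act by (rule group_hom)
  note fin = \<open>finite (carrier G)\<close> and inv = \<open>invariant_measure G act M\<close>
    and km = \<open>is_rkhs K H ip\<close> \<open>lam > 0\<close> \<open>equivariant_kernel_method G act K H ip l lam\<close>
    and A = \<open>A = kernel_method H ip l lam\<close>
    and h = \<open>h \<in> L2 M\<close> \<open>l2_norm M h = 1\<close>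
  have ne: "carrier G \<noteq> {}" using G.one_closed by auto
  note bound = sample_size_bound[OF fin inv km h, folded A]
  define b where "b = real (card (carrier G)) / mat_opnorm (carrier G) (gram act M h) * (1 - eps)"
  have "b = (1 - eps) / alignment G act M h"
    by (simp add: b_def alignment_eq_opnorm[OF fin ne inv h])
  moreover have "ereal b \<le> ereal_of_enat (min (enat n) (fun_dim H))"
    if ach: "achieves_iid M A h eps n" for n
  proof -
    obtain xs where "length xs = n"
      "\<And>g. g \<in> carrier G \<Longrightarrow> A (labelled h (map (act g) xs)) \<in> L2 M"
      "(\<Sum>g\<in>carrier G. sq_error M A h (map (act g) xs)) < real (card (carrier G)) * eps"
      using achieves_iid_orbit_sample[OF fin ne inv \<open>prob_space M\<close> ach] by blast
    then show ?thesis using bound[of xs eps] by (simp add: b_def)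
  qed
  moreover have "ereal b \<le> ereal_of_enat (min (enat (length xs)) (fun_dim H))"
    if xs: "\<forall>g\<in>carrier G. achieves M A h eps (map (act g) xs)" for xs
  proof -
    have "(\<Sum>g\<in>carrier G. sq_error M A h (map (act g) xs)) \<le> real (card (carrier G)) * eps"
      using xs by (intro sum_bounded_above) (auto simp: achieves_def)
    then show ?thesis using bound[of xs eps] xs by (simp add: b_def achieves_def)
  qed
  moreover have "ereal b \<le> ereal_of_enat (fun_dim H)" if "achieves M A h eps xs" for xs
    unfolding b_def
    by (rule rkhs_dimension_bound[OF _ fin inv km h]) (use surj_prop that A in auto)
  ultimately show ?thesis unfolding Let_def b_def by blast
qed

end
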